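(* Let $U\subset\mathbb{R}^n$ be open. Given a holomorphic regularisation procedure $\mathcal{R}:\omega\mapsto\omega(z)$ on $\Omega\,CS_{\rm com}(U)$ induced by a holomorphic regularisation procedure $\mathcal{R}:\sigma\mapsto\sigma(z)$ on $CS_{\rm com}(U)$, and any symbol valued form $\omega\in\Omega\,CS_{\rm com}(U)$, the following equality of meromorphic functions of $z$ holds: $$-\!\!\!\!\!\int_{T_x^*U}d\left(\omega(z)\right)=0.$$
   Context: $U\subset\mathbb{R}^n$ is open, $x\in U$, $T^*U=U\times\mathbb{R}^n$ with coordinates $(x,\xi)$, $|\xi|$ the Euclidean norm, $d$ the exterior differential on $T^*U$. $S^m(U)$ denotes symbols of order $m$. Fix a smooth function $\chi$ on $T^*U$ with $\chi=0$ for $|\xi|\le 1/2$ and $\chi=1$ for $|\xi|\ge 1$. A symbol $\sigma$ is classical of order $m\in\mathbb{C}$ if for every positive integer $N$, $\sigma=\sum_{i=0}^N\chi\,\sigma_{m-i}+\sigma_{(N)}$ with $\sigma_{m-i}$ positively homogeneous of degree $m-i$ in $\xi\ne0$ and $\sigma_{(N)}$ a symbol of order $m-N-1$ (i.e. $\mathrm{Re}(m)-N-1$). $CS^m_{\rm com}(U)$: classical symbols of order $m$ with compact support in $x\in U$; $CS_{\rm com}(U)$: algebra generated by them over all $m\in\mathbb{C}$. A symbol valued form of order $m$ is $\sum_{I,J}\alpha_{I,J}\,dx_I\wedge d\xi_J$ with $\alpha_{I,J}\in CS_{\rm com}^{m-|J|}(U)$; $\Omega\,CS_{\rm com}(U)$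 is generated by these over all orders and degrees. Holomorphic regularisation on $CS_{\rm com}(U)$: a map $\sigma\mapsto\sigma(z)$ to holomorphic families (in a complex parameter $z$) with values in $CS_{\rm com}(U)$, with $\sigma(0)=\sigma$ and $\sigma(z)$ of holomorphic order $\alpha(z)$ (so $\alpha(0)$ is the order of $\sigma$) such that $\alpha'(0)\ne0$. Holomorphic means: each homogeneous component $\sigma_{\alpha(z)-j}(z)$ is holomorphic in $z$, and for any integer $N\ge1$ the remainder $\sigma_{(N)}(z)=\sigma(z)-\sum_{j=0}^{N-1}\chi\,\sigma_{\alpha(z)-j}(z)$ is holomorphic in $z$ as an element of $C^\infty(U\times\mathbb{R}^n)$, with $k$-th $z$-derivative in $S^{\mathrm{Re}\,\alpha(z)-N+\epsilon}(U)$ for any $\epsilon>0$. The induced holomorphic regularisation on forms acts on coefficients: $\omega(z)=\sum_{I,J}\omega_{I,J}(z)\,dx_I\wedge d\xi_J$, with $\omega(0)=\omega$ and $\omega(z)$ of holomorphic order $\alpha(z)$ such that $\alpha'(0)\ne0$; thus $\omega_{I,J}(z)$ has order $\alpha(z)-|J|$. Cut-off integral: for a classical symbol $\sigma$, $-\!\!\!\!\int_{T_x^*U}\sigma(x,\xi)\,d\xi$ is the constant term in the asymptotic expansion of $\int_{|\xi|\le R}\sigma(x,\xi)\,d\xi$ as $R\to\infty$ (in powers of $R$ with nonzero exponents, $\log R$ and a constant). For a form $\alpha=\sum\alpha_{I,J}\,dx_I\wedge d\xi_J$, $-\!\!\!\!\int_{T_x^*U}\alpha=\sum_{I,\,|J|=n}\big(-\!\!\!\!\int_{T_x^*U}\alpha_{I,J}(x,\xi)\,d\xi\big)dx_I$,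 terms with $|J|\ne n$ contributing $0$ (meromorphy being understood coefficientwise).
   Formalization: With the full d on T*U and all dx_I kept, the claim fails for φ(x)exp(-|ξ|²)dξ_1∧…∧dξ_n: d_x of the fibre integral remains. Proved instead: the dx-free coefficient vanishes for the full d, and all dx_I coefficients vanish when d differentiates only in ξ along the fibre T_x^*U. *)

theory Defs
  imports "HOL-Complex_Analysis.Complex_Analysis"
begin

text \<open>Points of \<open>T*U\<close> are pairs \<open>(x, \<xi>)\<close>. The index type \<open>'n\<close> of the coordinates is linearly ordered
  where differential forms are written in terms of increasing multi-indices.\<close>

type_synonym 'n cotangent = "(real ^ 'n) \<times> (real ^ 'n)"
type_synonym 'n symb = "(real ^ 'n) \<times> (real ^ 'n) \<Rightarrow> complex"


subsection \<open>Smooth functions\<close>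

definition pd :: "'a::euclidean_space \<Rightarrow> ('a \<Rightarrow> 'b::real_normed_vector) \<Rightarrow> 'a \<Rightarrow> 'b" where
  "pd v f p = frechet_derivative f (at p) v"

definition pds :: "'a::euclidean_space list \<Rightarrow> ('a \<Rightarrow> 'b::real_normed_vector) \<Rightarrow> 'a \<Rightarrow> 'b" where
  "pds vs f = foldr pd vs f"

text \<open>The following two notions are meant for open sets \<open>S\<close> only.\<close>

primrec Ck_on :: "nat \<Rightarrow> 'a::euclidean_space set \<Rightarrow> ('a \<Rightarrow> 'b::real_normed_vector) \<Rightarrow> bool" where
  "Ck_on 0 S f \<longleftrightarrow> continuous_on S f"
| "Ck_on (Suc k) S f \<longleftrightarrow> f differentiable_on S \<and> (\<forall>b\<in>Basis. Ck_on k S (pd b f))"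

definition smooth_on :: "'a::euclidean_space set \<Rightarrow> ('a \<Rightarrow> 'b::real_normed_vector) \<Rightarrow> bool" where
  "smooth_on S f \<longleftrightarrow> (\<forall>k. Ck_on k S f)"

text \<open>Holomorphy on the open set \<open>W\<close> with values in the Frechet space \<open>C\<^sup>\<infinity>(S)\<close>: the difference quotients
  converge, with all their partial derivatives, uniformly on compact subsets of \<open>S\<close>.\<close>

definition Cinf_holomorphic ::
  "complex set \<Rightarrow> 'a::euclidean_space set \<Rightarrow> (complex \<Rightarrow> 'a \<Rightarrow> complex) \<Rightarrow> bool" where
  "Cinf_holomorphic W S f \<longleftrightarrow>
     (\<forall>z\<in>W. smooth_on S (f z)) \<and>
     (\<forall>z\<in>W. \<exists>g. smooth_on S g \<and>
        (\<forall>vs K. set vs \<subseteq> Basis \<and> compact K \<and> K \<subseteq> S \<longrightarrow>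
           uniform_limit K (\<lambda>h. pds vs (\<lambda>p. (f (z + h) p - f z p) / h)) (pds vs g) (at 0)))"


subsection \<open>Symbols\<close>

definition dx_dir :: "'n::finite \<Rightarrow> 'n cotangent" where
  "dx_dir i = (axis i 1, 0)"

definition dxi_dir :: "'n::finite \<Rightarrow> 'n cotangent" where
  "dxi_dir j = (0, axis j 1)"

text \<open>Multi-indices are represented by lists of coordinate indices, the order of a multi-index being
  the length of the list.\<close>

definition symbols :: "(real ^ 'n::finite) set \<Rightarrow> real \<Rightarrow> 'n symb set" where
  "symbols U m = {\<sigma>. smooth_on (U \<times> UNIV) \<sigma> \<and>
     (\<forall>K is js. compact K \<and> K \<subseteq> U \<longrightarrow>
        (\<exists>C. \<forall>x\<in>K. \<forall>\<xi>. norm (pds (map dx_dir is @ map dxi_dir js) \<sigma> (x, \<xi>))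
               \<le> C * (1 + norm \<xi>) powr (m - real (length js))))}"

definition excision_function :: "(real ^ 'n::finite) set \<Rightarrow> 'n symb \<Rightarrow> bool" where
  "excision_function U \<psi> \<longleftrightarrow> smooth_on (U \<times> UNIV) \<psi> \<and>
     (\<forall>x\<in>U. \<forall>\<xi>. (norm \<xi> \<le> 1/2 \<longrightarrow> \<psi> (x, \<xi>) = 0) \<and> (norm \<xi> \<ge> 1 \<longrightarrow> \<psi> (x, \<xi>) = 1))"

definition homogeneous_symbol :: "(real ^ 'n::finite) set \<Rightarrow> complex \<Rightarrow> 'n symb \<Rightarrow> bool" where
  "homogeneous_symbol U a s \<longleftrightarrow> smooth_on (U \<times> (UNIV - {0})) s \<and>
     (\<forall>x\<in>U. \<forall>\<xi>. \<forall>t>0. \<xi> \<noteq> 0 \<longrightarrow> s (x, t *\<^sub>R \<xi>) = of_real t powr a * s (x, \<xi>))"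

definition classical_symbols ::
  "(real ^ 'n::finite) set \<Rightarrow> 'n symb \<Rightarrow> complex \<Rightarrow> 'n symb set" where
  "classical_symbols U \<psi> m = {\<sigma> \<in> symbols U (Re m).
     \<exists>s :: nat \<Rightarrow> 'n symb.
       (\<forall>i. homogeneous_symbol U (m - of_nat i) (s i)) \<and>
       (\<forall>N\<ge>1. (\<lambda>p. \<sigma> p - (\<Sum>i\<le>N. \<psi> p * s i p)) \<in> symbols U (Re m - real N - 1))}"

text \<open>Functions with compact support in \<open>x \<in> U\<close> are extended by zero to all \<open>x\<close>, so that they are
  determined by their values on \<open>T*U\<close>.\<close>

definition CSm_com :: "(real ^ 'n::finite) set \<Rightarrow> 'n symb \<Rightarrow> complex \<Rightarrow> 'n symb set" where
  "CSm_com U \<psi> m = {\<sigma> \<in> classical_symbols U \<psi> m.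
     \<exists>K. compact K \<and> K \<subseteq> U \<and> (\<forall>x \<xi>. x \<notin> K \<longrightarrow> \<sigma> (x, \<xi>) = 0)}"

inductive_set CS_com :: "(real ^ 'n::finite) set \<Rightarrow> 'n symb \<Rightarrow> 'n symb set"
  for U :: "(real ^ 'n::finite) set" and \<psi> :: "'n symb" where
  base: "\<sigma> \<in> CSm_com U \<psi> m \<Longrightarrow> \<sigma> \<in> CS_com U \<psi>"
| scale: "\<sigma> \<in> CS_com U \<psi> \<Longrightarrow> (\<lambda>p. c * \<sigma> p) \<in> CS_com U \<psi>"
| add: "\<sigma> \<in> CS_com U \<psi> \<Longrightarrow> \<tau> \<in> CS_com U \<psi> \<Longrightarrow> (\<lambda>p. \<sigma> p + \<tau> p) \<in> CS_com U \<psi>"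
| mult: "\<sigma> \<in> CS_com U \<psi> \<Longrightarrow> \<tau> \<in> CS_com U \<psi> \<Longrightarrow> (\<lambda>p. \<sigma> p * \<tau> p) \<in> CS_com U \<psi>"


subsection \<open>Holomorphic families and regularisations\<close>

definition holomorphic_family ::
  "(real ^ 'n::finite) set \<Rightarrow> 'n symb \<Rightarrow> complex set \<Rightarrow> (complex \<Rightarrow> complex) \<Rightarrow> (complex \<Rightarrow> 'n symb) \<Rightarrow> bool"
where
  "holomorphic_family U \<psi> W \<alpha> \<tau> \<longleftrightarrow>
     \<alpha> holomorphic_on W \<and> (\<forall>z\<in>W. \<tau> z \<in> CSm_com U \<psi> (\<alpha> z)) \<and>
     (\<exists>s :: nat \<Rightarrow> complex \<Rightarrow> 'n symb.
        (\<forall>j. (\<forall>z\<in>W. homogeneous_symbol U (\<alpha> z - of_nat j) (s j z)) \<and>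
             Cinf_holomorphic W (U \<times> (UNIV - {0})) (s j)) \<and>
        (\<forall>N\<ge>1. let r = (\<lambda>z p. \<tau> z p - (\<Sum>j<N. \<psi> p * s j z p)) in
             Cinf_holomorphic W (U \<times> UNIV) r \<and>
             (\<forall>k. \<forall>\<epsilon>>0. \<forall>z\<in>W.
                (\<lambda>p. (deriv ^^ k) (\<lambda>w. r w p) z) \<in> symbols U (Re (\<alpha> z) - real N + \<epsilon>))))"

text \<open>A classical symbol is regularised by a family with an order \<open>\<alpha>\<close>; evaluating at 0 shows that \<open>\<alpha>(0)\<close>
  is an order of the symbol. A general element of the algebra is a finite sum of classical
  symbols whose orders need not differ by integers, hence has no order itself; it is
  regularised by a finite sum of families with orders.\<close>

definition holomorphic_regularisation ::
  "(real ^ 'n::finite) set \<Rightarrow> 'n symb \<Rightarrow> complex set \<Rightarrow> ('n symb \<Rightarrow> complex \<Rightarrow> 'n symb) \<Rightarrow> bool"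
where
  "holomorphic_regularisation U \<psi> W R \<longleftrightarrow>
     (\<forall>\<sigma>\<in>CS_com U \<psi>.
        R \<sigma> 0 = \<sigma> \<and> (\<forall>z\<in>W. R \<sigma> z \<in> CS_com U \<psi>) \<and>
        (\<exists>(k::nat) \<alpha> \<tau>.
           (\<forall>i<k. holomorphic_family U \<psi> W (\<alpha> i) (\<tau> i) \<and> deriv (\<alpha> i) 0 \<noteq> 0) \<and>
           (\<forall>z\<in>W. \<forall>p. R \<sigma> z p = (\<Sum>i<k. \<tau> i z p)))) \<and>
     (\<forall>m. \<forall>\<sigma>\<in>CSm_com U \<psi> m.
        \<exists>\<alpha>. \<sigma> \<in> CSm_com U \<psi> (\<alpha> 0) \<and> deriv \<alpha> 0 \<noteq> 0 \<and> holomorphic_family U \<psi> W \<alpha> (R \<sigma>))"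


subsection \<open>Symbol valued forms\<close>

text \<open>\<open>\<omega> I J\<close> is the coefficient of \<open>dx\<^sub>I \<and> d\<xi>\<^sub>J\<close>, with the factors in increasing order.\<close>

type_synonym 'n form = "'n set \<Rightarrow> 'n set \<Rightarrow> 'n symb"

text \<open>For disjoint \<open>A\<close>, \<open>B\<close> one has \<open>dx\<^sub>A \<and> dx\<^sub>B = shuffle_sign A B dx\<^bsub>A \<union> B\<^esub>\<close>.\<close>

definition shuffle_sign :: "'n::{finite,linorder} set \<Rightarrow> 'n set \<Rightarrow> complex" where
  "shuffle_sign A B = (-1) ^ card {(a, b). a \<in> A \<and> b \<in> B \<and> b < a}"

definition wedge :: "'n::{finite,linorder} form \<Rightarrow> 'n form \<Rightarrow> 'n form" where
  "wedge \<omega> \<eta> K L p = (\<Sum>I\<in>Pow K. \<Sum>J\<in>Pow L.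
     (-1) ^ (card J * card (K - I)) * shuffle_sign I (K - I) * shuffle_sign J (L - J)
       * \<omega> I J p * \<eta> (K - I) (L - J) p)"

definition symbol_forms_of_order ::
  "(real ^ 'n::finite) set \<Rightarrow> 'n symb \<Rightarrow> complex \<Rightarrow> 'n form set" where
  "symbol_forms_of_order U \<psi> m = {\<omega>. \<forall>I J. \<omega> I J \<in> CSm_com U \<psi> (m - of_nat (card J))}"

inductive_set Omega_CS_com :: "(real ^ 'n::{finite,linorder}) set \<Rightarrow> 'n symb \<Rightarrow> 'n form set"
  for U :: "(real ^ 'n::{finite,linorder}) set" and \<psi> :: "'n symb" where
  base: "\<omega> \<in> symbol_forms_of_order U \<psi> m \<Longrightarrow> \<omega> \<in> Omega_CS_com U \<psi>"
| scale: "\<omega> \<in> Omega_CS_com U \<psi> \<Longrightarrow> (\<lambda>I J p. c * \<omega> I J p) \<in> Omega_CS_com U \<psi>"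
| add: "\<omega> \<in> Omega_CS_com U \<psi> \<Longrightarrow> \<eta> \<in> Omega_CS_com U \<psi>
    \<Longrightarrow> (\<lambda>I J p. \<omega> I J p + \<eta> I J p) \<in> Omega_CS_com U \<psi>"
| wedge: "\<omega> \<in> Omega_CS_com U \<psi> \<Longrightarrow> \<eta> \<in> Omega_CS_com U \<psi> \<Longrightarrow> wedge \<omega> \<eta> \<in> Omega_CS_com U \<psi>"

definition induced_regularisation ::
  "('n symb \<Rightarrow> complex \<Rightarrow> 'n symb) \<Rightarrow> 'n form \<Rightarrow> complex \<Rightarrow> 'n form" where
  "induced_regularisation R \<omega> z = (\<lambda>I J. R (\<omega> I J) z)"

text \<open>The two parts of the exterior differential:
  \<open>d(f dx\<^sub>I \<and> d\<xi>\<^sub>J) = (\<Sum>i. \<partial>f/\<partial>x\<^sub>i dx\<^sub>i \<and> dx\<^sub>I \<and> d\<xi>\<^sub>J) + (\<Sum>j. (-1)\<^bsup>card I\<^esup> \<partial>f/\<partial>\<xi>\<^sub>j dx\<^sub>I \<and> d\<xi>\<^sub>j \<and> d\<xi>\<^sub>J)\<close>.\<close>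

definition base_differential :: "'n::{finite,linorder} form \<Rightarrow> 'n form" where
  "base_differential \<omega> I J p =
     (\<Sum>i\<in>I. shuffle_sign {i} (I - {i}) * pd (dx_dir i) (\<omega> (I - {i}) J) p)"

definition fibre_differential :: "'n::{finite,linorder} form \<Rightarrow> 'n form" where
  "fibre_differential \<omega> I J p =
     (\<Sum>j\<in>J. (-1) ^ card I * shuffle_sign {j} (J - {j}) * pd (dxi_dir j) (\<omega> I (J - {j})) p)"

definition ext_differential :: "'n::{finite,linorder} form \<Rightarrow> 'n form" where
  "ext_differential \<omega> I J p = base_differential \<omega> I J p + fibre_differential \<omega> I J p"


subsection \<open>Cut-off integrals\<close>

definition has_cutoff_integral :: "(real ^ 'n::finite \<Rightarrow> complex) \<Rightarrow> complex \<Rightarrow> bool" where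
  "has_cutoff_integral f c \<longleftrightarrow>
     (\<exists>(E :: complex set) a b. finite E \<and> 0 \<notin> E \<and>
        ((\<lambda>R. integral (cball 0 R) f - (\<Sum>e\<in>E. a e * of_real R powr e) - b * of_real (ln R))
           \<longlongrightarrow> c) at_top)"

definition cutoff_integral :: "(real ^ 'n::finite \<Rightarrow> complex) \<Rightarrow> complex" where
  "cutoff_integral f = (THE c. has_cutoff_integral f c)"

text \<open>\<open>fibre_cutoff_integral x \<omega> I\<close> is the coefficient of \<open>dx\<^sub>I\<close> in the cut-off integral of \<open>\<omega>\<close> over the
  fibre at \<open>x\<close>. The coefficient at \<open>I = {}\<close> is the integral of the restriction (pull-back) of \<open>\<omega>\<close> to the
  submanifold \<open>{x} \<times> \<real>\<^sup>n\<close>.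

  Integration over the fibre does not annihilate the part \<open>base_differential\<close> of the exterior
  differential: it turns it into the differential, on \<open>U\<close>, of the fibre integral. So an exact form
  has vanishing fibre integral in two senses: after restriction to the fibre; or, for the coefficient
  of every \<open>dx\<^sub>I\<close>, if \<open>x\<close> is held fixed and the form is differentiated along the fibre.\<close>

definition fibre_cutoff_integral ::
  "real ^ 'n::finite \<Rightarrow> 'n form \<Rightarrow> 'n set \<Rightarrow> complex" where
  "fibre_cutoff_integral x \<omega> I = cutoff_integral (\<lambda>\<xi>. \<omega> I UNIV (x, \<xi>))"

text \<open>Equality to zero as a meromorphic function on \<open>W\<close>. The values at the points of a sparse set,
  which contains the possible poles, are irrelevant.\<close>

definition meromorphic_zero_on :: "complex set \<Rightarrow> (complex \<Rightarrow> complex) \<Rightarrow> bool" where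
  "meromorphic_zero_on W F \<longleftrightarrow> F meromorphic_on W \<and> (\<forall>\<^sub>\<approx>z\<in>W. F z = 0)"

end

theory Submission
  imports Defs
begin

text \<open>Write \<open>\<chi>\<close> for the excision function on the fibre at \<open>x\<close>. Since \<open>(1 - \<chi>(\<xi>/R)) \<sigma>\<close> is supported in the
  ball of radius \<open>R\<close>, the integral of \<open>\<partial>\<sigma>/\<partial>\<xi>\<^sub>j\<close> over this ball equals that of \<open>\<partial>/\<partial>\<xi>\<^sub>j (\<chi>(\<xi>/R) \<sigma>)\<close>, which
  sees \<open>\<sigma>\<close> only on \<open>R/2 \<le> |\<xi>| \<le> R\<close>. By scaling, a homogeneous component of degree \<open>a\<close> contributes
  exactly a multiple of \<open>R\<close> to the power \<open>a - 1 + n\<close>, and a remainder of order below \<open>1 - n\<close> contributes \<open>o(1)\<close>.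
  So no constant term occurs unless the order is an integer. As \<open>\<alpha>'(0) \<noteq> 0\<close>, the set of \<open>z\<close> with
  \<open>\<alpha>(z)\<close> an integer is discrete, being contained in the zeros of \<open>sin (\<pi> \<alpha>(z))\<close>.\<close>

subsection \<open>Directional derivatives and cut-offs\<close>

text \<open>Only the derivative along one fixed direction is integrated below. Carrying it as a
  function \<open>f'\<close> keeps the product and rescaling formulas explicit; its continuity
  serves integrability over balls and differentiation under the integral.\<close>

definition C1_dir_on ::
  "'a::euclidean_space set \<Rightarrow> 'a \<Rightarrow> ('a \<Rightarrow> complex) \<Rightarrow> ('a \<Rightarrow> complex) \<Rightarrow> bool" where
  "C1_dir_on S v f f' \<longleftrightarrow> continuous_on S f \<and> continuous_on S f' \<and>
     (\<forall>p\<in>S. ((\<lambda>t. f (p + t *\<^sub>R v)) has_vector_derivative f' p) (at 0))"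

lemma C1_dir_on_line:
  assumes "C1_dir_on UNIV v f f'"
  shows "((\<lambda>t. f (p + t *\<^sub>R v)) has_vector_derivative f' (p + s *\<^sub>R v)) (at s)"
proof -
  have "((\<lambda>t. f ((p + s *\<^sub>R v) + t *\<^sub>R v)) has_vector_derivative f' (p + s *\<^sub>R v)) (at (s - s))"
    using assms by (auto simp: C1_dir_on_def)
  then have "((\<lambda>t. f ((p + s *\<^sub>R v) + t *\<^sub>R v)) \<circ> (\<lambda>t. t - s) has_vector_derivative
      1 *\<^sub>R f' (p + s *\<^sub>R v)) (at s)"
    by (intro vector_diff_chain_at) (auto intro!: derivative_eq_intros)
  then show ?thesis by (simp add: o_def algebra_simps)
qed

text \<open>Serves to equate two formulas for one derivative without manipulating either of
  them.\<close>

lemma C1_dir_on_unique: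
  assumes "C1_dir_on S v f f'" "C1_dir_on S v f f''" "p \<in> S"
  shows "f' p = f'' p"
  using assms vector_derivative_unique_at unfolding C1_dir_on_def by blast

lemma C1_dir_on_add:
  assumes "C1_dir_on S v f f'" "C1_dir_on S v g g'"
  shows "C1_dir_on S v (\<lambda>p. f p + g p) (\<lambda>p. f' p + g' p)"
  using assms unfolding C1_dir_on_def
  by (auto intro!: continuous_intros has_vector_derivative_add)

lemma C1_dir_on_cmult:
  assumes "C1_dir_on S v f f'"
  shows "C1_dir_on S v (\<lambda>p. c * f p) (\<lambda>p. c * f' p)"
  using assms unfolding C1_dir_on_def
  by (auto intro!: continuous_intros has_vector_derivative_mult_right)

lemma C1_dir_on_sum:
  assumes "\<And>i. i \<in> I \<Longrightarrow> C1_dir_on S v (f i) (f' i)"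
  shows "C1_dir_on S v (\<lambda>p. \<Sum>i\<in>I. f i p) (\<lambda>p. \<Sum>i\<in>I. f' i p)"
  using assms unfolding C1_dir_on_def
  by (auto intro!: continuous_intros has_vector_derivative_sum)

lemma C1_dir_on_mult:
  assumes "C1_dir_on S v f f'" "C1_dir_on S v g g'"
  shows "C1_dir_on S v (\<lambda>p. f p * g p) (\<lambda>p. f' p * g p + f p * g' p)"
proof -
  have "((\<lambda>t. f (p + t *\<^sub>R v) * g (p + t *\<^sub>R v)) has_vector_derivative f' p * g p + f p * g' p) (at 0)"
    if "p \<in> S" for p
    using has_vector_derivative_mult[of "\<lambda>t. f (p + t *\<^sub>R v)" "f' p" 0 UNIV
        "\<lambda>t. g (p + t *\<^sub>R v)" "g' p"] assms that
    by (simp add: C1_dir_on_def add.commute)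
  then show ?thesis
    using assms unfolding C1_dir_on_def by (auto intro!: continuous_intros)
qed

lemma C1_dir_on_rescale:
  assumes "C1_dir_on UNIV v f f'" "c \<noteq> 0"
  shows "C1_dir_on UNIV v (\<lambda>p. f (p /\<^sub>R c)) (\<lambda>p. f' (p /\<^sub>R c) / of_real c)"
proof -
  have "((\<lambda>t. f ((p + t *\<^sub>R v) /\<^sub>R c)) has_vector_derivative f' (p /\<^sub>R c) / of_real c) (at 0)" for p
  proof -
    have "((\<lambda>t. f (p /\<^sub>R c + t *\<^sub>R v)) has_vector_derivative f' (p /\<^sub>R c)) (at (0 / c))"
      using assms by (simp add: C1_dir_on_def)
    then have "((\<lambda>t. f (p /\<^sub>R c + t *\<^sub>R v)) \<circ> (\<lambda>t. t / c) has_vector_derivative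
       (1 / c) *\<^sub>R f' (p /\<^sub>R c)) (at 0)"
      by (intro vector_diff_chain_at)
         (use assms(2) in \<open>auto intro!: derivative_eq_intros simp flip: has_real_derivative_iff_has_vector_derivative\<close>)
    then show ?thesis 
      using assms(2) by (simp add: o_def algebra_simps scaleR_conv_of_real divide_inverse)
  qed
  moreover have "continuous_on UNIV (\<lambda>p. g (p /\<^sub>R c))" if "continuous_on UNIV g" for g :: "'a \<Rightarrow> complex"
    by (rule continuous_on_compose2[OF that]) (auto intro!: continuous_intros)
  ultimately show ?thesis
    using assms unfolding C1_dir_on_def divide_inverse
    by (intro conjI ballI continuous_on_mult_right) auto
qed

lemma C1_dir_on_Un:
  assumes "C1_dir_on S v f f'" "C1_dir_on T v f f'" "open S" "open T"
  shows "C1_dir_on (S \<union> T) v f f'"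
  using assms unfolding C1_dir_on_def by (auto intro: continuous_on_open_Un)

text \<open>Covers regions where a cut-off factor is zero, whatever the other factor does there. The
  preimage of \<open>S\<close> under the line through \<open>p\<close> is an open neighbourhood of 0
  on which the function vanishes.\<close>

lemma C1_dir_on_zero:
  assumes "open S" "\<And>p. p \<in> S \<Longrightarrow> f p = 0" "\<And>p. p \<in> S \<Longrightarrow> f' p = 0"
  shows "C1_dir_on S v f f'"
proof -
  have "((\<lambda>t. f (p + t *\<^sub>R v)) has_vector_derivative f' p) (at 0)" if "p \<in> S" for p
  proof -
    have op: "open ((\<lambda>t. p + t *\<^sub>R v) -` S)"
      using assms(1) by (intro open_vimage continuous_intros)
    show ?thesis
      by (rule has_vector_derivative_transform_within_open[of "\<lambda>_. 0" "f' p" 0 "(\<lambda>t. p + t *\<^sub>R v) -` S"])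
         (use op assms(2,3) that in simp_all)
  qed
  moreover have "continuous_on S f" "continuous_on S f'"
    using assms continuous_on_cong[of S S _ "\<lambda>_. 0 :: complex"] by (simp_all cong: continuous_on_cong)
  ultimately show ?thesis by (auto simp: C1_dir_on_def)
qed

lemma C1_dir_on_eq_0:
  assumes "C1_dir_on S v f f'" "open T" "T \<subseteq> S" "\<And>q. q \<in> T \<Longrightarrow> f q = 0" "p \<in> T"
  shows "f' p = 0"
proof -
  have "C1_dir_on T v f f'"
    using assms(1,3) unfolding C1_dir_on_def by (blast intro: continuous_on_subset)
  moreover have "C1_dir_on T v f (\<lambda>_. 0)"
    using assms(2,4) by (rule C1_dir_on_zero) simp_all
  ultimately show ?thesis using assms(5) by (rule C1_dir_on_unique)
qed

section \<open>Integration over balls\<close>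

lemma integrable_continuous_cball:
  fixes f :: "'a::euclidean_space \<Rightarrow> complex"
  assumes "continuous_on (cball a r) f"
  shows "f integrable_on cball a r"
proof -
  have "set_integrable lborel (cball a r) f"
    unfolding set_integrable_def using assms by (intro borel_integrable_compact) auto
  then show ?thesis by (rule set_borel_integral_eq_integral)
qed

text \<open>Linear change of variables on a box around the unit ball, applied to the extension of
  \<open>f\<close> by zero; the result is then cut back to the ball.\<close>

lemma integral_scaled_cball:
  fixes f :: "'a::euclidean_space \<Rightarrow> complex"
  assumes "f integrable_on cball 0 1" "R > 0"
  shows "integral (cball 0 R) (\<lambda>p. f (p /\<^sub>R R)) = of_real R ^ DIM('a) * integral (cball 0 1) f"
proof -
  define g where "g p = (if p \<in> cball 0 1 then f p else 0)" for p
  obtain a where a: "cball 0 1 \<subseteq> cbox (-a) (a::'a)"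
    using bounded_subset_cbox_symmetric[of "cball (0::'a) 1"] by blast
  have "(g has_integral integral (cball 0 1) f) (cbox (-a) a)"
    unfolding g_def has_integral_restrict[OF a] using assms by blast
  from has_integral_affinity'[OF this, of "1 / R" 0]
  have "((\<lambda>p. g (p /\<^sub>R R)) has_integral R ^ DIM('a) *\<^sub>R integral (cball 0 1) f)
      (cbox (- (R *\<^sub>R a)) (R *\<^sub>R a))"
    using assms by (simp add: field_simps)
  moreover have "(\<lambda>p. g (p /\<^sub>R R)) = (\<lambda>p. if p \<in> cball 0 R then f (p /\<^sub>R R) else 0)"
    using assms by (auto simp: g_def field_simps fun_eq_iff)
  moreover have "cball 0 R \<subseteq> cbox (- (R *\<^sub>R a)) (R *\<^sub>R a)"
  proof
    fix p :: 'a assume "p \<in> cball 0 R"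
    then have "p /\<^sub>R R \<in> cball 0 1" using assms by (simp add: field_simps)
    then have "p /\<^sub>R R \<in> cbox (-a) a" using a by blast
    then show "p \<in> cbox (- (R *\<^sub>R a)) (R *\<^sub>R a)"
      using assms by (auto simp: mem_box field_simps)
  qed
  ultimately have "((\<lambda>p. f (p /\<^sub>R R)) has_integral R ^ DIM('a) *\<^sub>R integral (cball 0 1) f) (cball 0 R)"
    by (simp only: has_integral_restrict)
  then show ?thesis by (simp add: integral_unique scaleR_conv_of_real)
qed

text \<open>By translation invariance \<open>\<integral> u (p + t v) dp\<close> does not depend on \<open>t\<close>.\<close>

lemma integral_C1_dir_compact_support:
  fixes u :: "'a::euclidean_space \<Rightarrow> complex"
  assumes u: "C1_dir_on UNIV v u u'" and supp: "\<And>p. norm p > R \<Longrightarrow> u p = 0"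
  shows "integral (cball 0 R) u' = 0"
proof -
  have cu: "continuous_on UNIV u" "continuous_on UNIV u'"
    using u by (auto simp: C1_dir_on_def)
  have supp': "u' p = 0" if "norm p > R" for p
    by (rule C1_dir_on_eq_0[OF u, of "- cball 0 R"]) (use supp that in auto)
  \<comment> \<open>The margin \<open>norm v\<close> keeps the support inside this box under shifts
    by \<open>t v\<close> with |t| \<le> 1.\<close>
  obtain a where a: "cball 0 (R + norm v) \<subseteq> cbox (-a) (a::'a)"
    using bounded_subset_cbox_symmetric[of "cball (0::'a) (R + norm v)"] by blast
  have subR: "cball 0 R \<subseteq> cbox (-a) a"
  proof -
    have "cball (0::'a) R \<subseteq> cball 0 (R + norm v)" by (rule subset_cball) simp
    then show ?thesis using a by blast
  qed
  define I where "I = integral UNIV u"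
  \<comment> \<open>Every box containing the ball gives the same integral, namely that over the
    whole space.\<close>
  have univ: "(u has_integral I) (cbox b c)" if "cball 0 R \<subseteq> cbox b c" for b c
  proof -
    have "u integrable_on cbox b c"
      using cu by (intro integrable_continuous) (auto intro: continuous_on_subset)
    then obtain k where k: "(u has_integral k) (cbox b c)" by blast
    have "(u has_integral k) UNIV"
    proof (rule has_integral_on_superset[OF k])
      fix p assume "p \<notin> cbox b c"
      then have "p \<notin> cball 0 R" using that by blast
      then show "u p = 0" using supp by simp
    qed simp
    then show ?thesis using k by (simp add: I_def integral_unique)
  qed
  define g where "g t = integral (cbox (-a) a) (\<lambda>p. u (p + t *\<^sub>R v))" for t
  have gI: "g t = I" if "t \<in> {-1..1}" for t
  proof -
    have "cball 0 R \<subseteq> cbox (-a + t *\<^sub>R v) (a + t *\<^sub>R v)"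
    proof
      fix p :: 'a assume p: "p \<in> cball 0 R"
      have "norm (p - t *\<^sub>R v) \<le> norm p + \<bar>t\<bar> * norm v"
        using norm_triangle_ineq4[of p "t *\<^sub>R v"] by simp
      also have "\<dots> \<le> R + 1 * norm v"
        using p that by (intro add_mono mult_right_mono) auto
      finally have "p - t *\<^sub>R v \<in> cbox (-a) a" using a by auto
      then show "p \<in> cbox (-a + t *\<^sub>R v) (a + t *\<^sub>R v)"
        by (auto simp: mem_box algebra_simps)
    qed
    from univ[OF this] show ?thesis
      using integral_shift_cbox_plus[of "-a" a u "t *\<^sub>R v"]
      by (simp add: g_def o_def add.commute integral_unique)
  qed
  \<comment> \<open>Leibniz' rule differentiates \<open>g\<close> at 0. As \<open>g\<close> is
    constant on [-1, 1], which has 0 in its interior, the derivative must be 0.\<close>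
  have "(g has_vector_derivative integral (cbox (-a) a) (\<lambda>p. u' (p + 0 *\<^sub>R v))) (at 0 within {-1..1})"
    unfolding g_def
  proof (rule leibniz_rule_vector_derivative[where fx = "\<lambda>t p. u' (p + t *\<^sub>R v)"])
    show "((\<lambda>t. u (p + t *\<^sub>R v)) has_vector_derivative u' (p + t *\<^sub>R v)) (at t within {-1..1})" for p t
      using C1_dir_on_line[OF u] by (rule has_vector_derivative_at_within)
    show "(\<lambda>p. u (p + t *\<^sub>R v)) integrable_on cbox (-a) a" for t
      using cu(1) by (intro integrable_continuous continuous_on_compose2[OF cu(1)] continuous_intros) auto
    show "continuous_on ({-1..1} \<times> cbox (-a) a) (\<lambda>(t, p). u' (p + t *\<^sub>R v))"
      unfolding case_prod_unfold
      by (intro continuous_on_compose2[OF cu(2)] continuous_intros) auto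
  qed auto
  moreover have "(g has_vector_derivative 0) (at 0 within {-1..1})"
    by (rule has_vector_derivative_transform[of _ _ _ "\<lambda>_. I"]) (use gI in auto)
  ultimately have "integral (cbox (-a) a) u' = 0"
    using vector_derivative_unique_at[of g "integral (cbox (-a) a) u'" 0 0]
    by (simp add: at_within_Icc_at)
  moreover have "integral (cball 0 R) u' = integral (cbox (-a) a) u'"
  proof -
    have "(u' has_integral integral (cball 0 R) u') (cball 0 R)"
      using cu(2) integrable_continuous_cball continuous_on_subset by blast
    then have "(u' has_integral integral (cball 0 R) u') (cbox (-a) a)"
      by (rule has_integral_on_superset) (use supp' subR in auto)
    then show ?thesis by (simp add: integral_unique)
  qed
  ultimately show ?thesis by simp
qed

section \<open>Integration by parts with a rescaled cut-off\<close>

text \<open>Models the restriction of the excision function to one fibre, with its derivative along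
  a coordinate direction of the fibre.\<close>

locale radial_cutoff =
  fixes v :: "'a::euclidean_space" and \<kappa> \<kappa>' :: "'a \<Rightarrow> complex"
  assumes chi: "C1_dir_on UNIV v \<kappa> \<kappa>'"
    and chi_0: "norm p \<le> 1/2 \<Longrightarrow> \<kappa> p = 0"
    and chi_1: "norm p \<ge> 1 \<Longrightarrow> \<kappa> p = 1"
begin

lemma chi'_0: "norm p < 1/2 \<Longrightarrow> \<kappa>' p = 0"
  by (rule C1_dir_on_eq_0[OF chi, of "ball 0 (1/2)"]) (auto intro: chi_0)

lemma rescaled_product:
  fixes f f' :: "'a \<Rightarrow> complex"
  assumes "C1_dir_on UNIV v f f'" "R > 0"
  shows "C1_dir_on UNIV v (\<lambda>p. \<kappa> (p /\<^sub>R R) * f p)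
     (\<lambda>p. \<kappa>' (p /\<^sub>R R) / of_real R * f p + \<kappa> (p /\<^sub>R R) * f' p)"
  using assms by (intro C1_dir_on_mult C1_dir_on_rescale chi) auto

text \<open>Integration by parts without boundary terms: \<open>(1 - \<kappa> (p / R)) f p\<close> is supported in the ball.\<close>

lemma integral_cball_cutoff:
  fixes f f' :: "'a \<Rightarrow> complex"
  assumes f: "C1_dir_on UNIV v f f'" and "R > 0"
  shows "integral (cball 0 R) f' =
     integral (cball 0 R) (\<lambda>p. \<kappa>' (p /\<^sub>R R) / of_real R * f p + \<kappa> (p /\<^sub>R R) * f' p)"
proof -
  let ?u' = "\<lambda>p. \<kappa>' (p /\<^sub>R R) / of_real R * f p + \<kappa> (p /\<^sub>R R) * f' p"
  \<comment> \<open>The factor -1 stands for subtraction, so that the rules for sums and multiples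
    supply the derivative.\<close>
  have "C1_dir_on UNIV v (\<lambda>p. f p + (-1) * (\<kappa> (p /\<^sub>R R) * f p)) (\<lambda>p. f' p + (-1) * ?u' p)"
    by (intro C1_dir_on_add C1_dir_on_cmult f rescaled_product assms)
  then have 0: "integral (cball 0 R) (\<lambda>p. f' p + (-1) * ?u' p) = 0"
  proof (rule integral_C1_dir_compact_support)
    fix p :: 'a assume "norm p > R"
    then have "\<kappa> (p /\<^sub>R R) = 1" using \<open>R > 0\<close> by (intro chi_1) (simp add: field_simps)
    then show "f p + (-1) * (\<kappa> (p /\<^sub>R R) * f p) = 0" by simp
  qed
  have "f' integrable_on cball 0 R" "?u' integrable_on cball 0 R"
    using f rescaled_product[OF assms]
    by (auto simp: C1_dir_on_def intro!: integrable_continuous_cball intro: continuous_on_subset)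
  from integral_diff[OF this]
  have "integral (cball 0 R) (\<lambda>p. f' p - ?u' p) = integral (cball 0 R) f' - integral (cball 0 R) ?u'" .
  moreover have "(\<lambda>p. f' p + (-1) * ?u' p) = (\<lambda>p. f' p - ?u' p)" by (simp add: fun_eq_iff)
  ultimately show ?thesis using 0 by (simp only: right_minus_eq)
qed

text \<open>The function \<open>s\<close> may be singular at the origin, but on the ball of radius
  1/2 the cut-off and its derivative vanish, so both displayed functions are 0 there. This open ball
  and the punctured space cover everything.\<close>

lemma product_punctured:
  assumes "C1_dir_on (- {0}) v s s'"
  shows "C1_dir_on UNIV v (\<lambda>p. \<kappa> p * s p) (\<lambda>p. \<kappa>' p * s p + \<kappa> p * s' p)"
proof -
  have "C1_dir_on (- {0}) v \<kappa> \<kappa>'"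
    using chi by (auto simp: C1_dir_on_def intro: continuous_on_subset)
  then have "C1_dir_on (- {0}) v (\<lambda>p. \<kappa> p * s p) (\<lambda>p. \<kappa>' p * s p + \<kappa> p * s' p)"
    using assms by (rule C1_dir_on_mult)
  moreover have "C1_dir_on (ball 0 (1/2)) v (\<lambda>p. \<kappa> p * s p) (\<lambda>p. \<kappa>' p * s p + \<kappa> p * s' p)"
    by (rule C1_dir_on_zero) (auto simp: chi_0 chi'_0)
  ultimately have "C1_dir_on (- {0} \<union> ball 0 (1/2)) v (\<lambda>p. \<kappa> p * s p) (\<lambda>p. \<kappa>' p * s p + \<kappa> p * s' p)"
    by (rule C1_dir_on_Un) auto
  moreover have "- {0} \<union> ball 0 (1/2) = (UNIV :: 'a set)" by auto
  ultimately show ?thesis by simp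
qed

text \<open>Cutting off once more at scale R turns \<open>\<kappa> * s\<close> into R to the power
  \<open>a\<close> times its dilate by R. Differentiating the dilate costs a factor 1/R, and
  integrating it over the dilated ball yields R to the power of the dimension.\<close>

lemma integral_homogeneous:
  fixes s s' :: "'a \<Rightarrow> complex" and a :: complex
  defines "d \<equiv> \<lambda>p. \<kappa>' p * s p + \<kappa> p * s' p"
  assumes s: "C1_dir_on (- {0}) v s s'"
    and hom: "\<And>t p. t > 0 \<Longrightarrow> p \<noteq> 0 \<Longrightarrow> s (t *\<^sub>R p) = of_real t powr a * s p"
    and R: "R \<ge> 2"
  shows "integral (cball 0 R) d =
    integral (cball 0 1) d * of_real R powr (a - 1 + of_nat DIM('a))"
proof -
  have R0: "R > 0" using R by simp
  have d: "C1_dir_on UNIV v (\<lambda>p. \<kappa> p * s p) d"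
    unfolding d_def by (rule product_punctured[OF s])
  \<comment> \<open>Beyond the radius R/2 \<ge> 1 the inner cut-off is already 1; up to that radius
    the outer one is 0. This is where R \<ge> 2 enters.\<close>
  have eq: "\<kappa> (p /\<^sub>R R) * (\<kappa> p * s p) = of_real R powr a * (\<kappa> (p /\<^sub>R R) * s (p /\<^sub>R R))" for p
  proof (cases "norm p \<le> R / 2")
    case True
    then have "\<kappa> (p /\<^sub>R R) = 0" using R0 by (intro chi_0) (simp add: field_simps)
    then show ?thesis by simp
  next
    case False
    then have "\<kappa> p = 1" "p \<noteq> 0" using R by (auto intro: chi_1)
    then show ?thesis using hom[of R "p /\<^sub>R R"] R0 by simp
  qed
  have "integral (cball 0 R) d = integral (cball 0 R)
     (\<lambda>p. \<kappa>' (p /\<^sub>R R) / of_real R * (\<kappa> p * s p) + \<kappa> (p /\<^sub>R R) * d p)"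
    by (rule integral_cball_cutoff[OF d R0])
  also have "\<dots> = integral (cball 0 R) (\<lambda>p. of_real R powr a * (d (p /\<^sub>R R) / of_real R))"
  proof (rule integral_cong)
    \<comment> \<open>Both integrands are derivatives of the function in \<open>eq\<close>, so
      uniqueness equates them without a homogeneity statement for \<open>s'\<close>.\<close>
    have "C1_dir_on UNIV v (\<lambda>p. of_real R powr a * (\<kappa> (p /\<^sub>R R) * s (p /\<^sub>R R)))
        (\<lambda>p. of_real R powr a * (d (p /\<^sub>R R) / of_real R))"
      using R0 by (intro C1_dir_on_cmult C1_dir_on_rescale[OF d]) simp
    then show "\<kappa>' (p /\<^sub>R R) / of_real R * (\<kappa> p * s p) + \<kappa> (p /\<^sub>R R) * d p
      = of_real R powr a * (d (p /\<^sub>R R) / of_real R)" for p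
      using C1_dir_on_unique[OF rescaled_product[OF d R0, unfolded eq]] by blast
  qed
  also have "\<dots> = of_real R powr a / of_real R * integral (cball 0 R) (\<lambda>p. d (p /\<^sub>R R))"
    by (simp flip: integral_mult_right)
  also have "integral (cball 0 R) (\<lambda>p. d (p /\<^sub>R R)) = of_real R ^ DIM('a) * integral (cball 0 1) d"
    using d R0 by (intro integral_scaled_cball integrable_continuous_cball)
      (auto simp: C1_dir_on_def intro: continuous_on_subset)
  also have "of_real R powr a / of_real R * (of_real R ^ DIM('a) * integral (cball 0 1) d)
     = integral (cball 0 1) d * of_real R powr (a - 1 + of_nat DIM('a))"
    using R0 by (simp add: powr_add powr_diff)
  finally show ?thesis .
qed

text \<open>After the cut-off the integrand lives on R/2 \<le> norm p \<le> R, where it is O(R^(m -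
  1)). The ball has volume of order R^n with n the dimension, and m - 1 + n < 0.\<close>

lemma integral_remainder_tendsto_0:
  fixes r r' :: "'a \<Rightarrow> complex" and m :: real
  assumes r: "C1_dir_on UNIV v r r'"
    and bound: "\<And>p. norm (r p) \<le> C * (1 + norm p) powr m"
    and bound': "\<And>p. norm (r' p) \<le> C' * (1 + norm p) powr (m - 1)"
    and m: "m < 1 - real DIM('a)"
  shows "((\<lambda>R. integral (cball 0 R) r') \<longlongrightarrow> 0) at_top"
proof -
  have cchi: "continuous_on UNIV \<kappa>" "continuous_on UNIV \<kappa>'"
    using chi by (auto simp: C1_dir_on_def)
  have bdd: "\<exists>M\<ge>0. \<forall>p\<in>cball 0 1. norm (f p) \<le> M"
    if "continuous_on UNIV f" for f :: "'a \<Rightarrow> complex"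
  proof -
    have "compact (f ` cball 0 1)"
      using that by (intro compact_continuous_image) (auto intro: continuous_on_subset)
    then obtain M where "\<forall>x\<in>f ` cball 0 1. norm x \<le> M"
      using compact_imp_bounded bounded_iff by blast
    then show ?thesis by (intro exI[of _ "max M 0"]) (auto simp: le_max_iff_disj)
  qed
  obtain M where M: "M \<ge> 0" "\<And>p. norm p \<le> 1 \<Longrightarrow> norm (\<kappa> p) \<le> M"
    using bdd[OF cchi(1)] by (auto simp: mem_cball_0)
  obtain M' where M': "M' \<ge> 0" "\<And>p. norm p \<le> 1 \<Longrightarrow> norm (\<kappa>' p) \<le> M'"
    using bdd[OF cchi(2)] by (auto simp: mem_cball_0)
  \<comment> \<open>At the origin the weight \<open>1 + norm p\<close> is 1.\<close>
  have "0 \<le> C" using bound[of 0] by (simp add: order_trans[OF norm_ge_zero])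
  have "0 \<le> C'" using bound'[of 0] by (simp add: order_trans[OF norm_ge_zero])
  \<comment> \<open>The dimension is at least 1. Nonpositive exponents make the weights decreasing,
    so that they may be estimated at R/2.\<close>
  have m0: "m \<le> 0" using m by (smt (verit) DIM_ge_Suc0 of_nat_1 of_nat_mono One_nat_def)
  \<comment> \<open>Bounds the cut-off derivative on the ball of radius R: one summand for each term
    of the product rule, with the weights taken at R/2.\<close>
  define B where "B R = M' / R * (C * (R / 2) powr m) + M * (C' * (R / 2) powr (m - 1))" for R
  define V where "V = integral (cball (0::'a) 1) (\<lambda>_. 1 :: real)"
  have est: "norm (integral (cball 0 R) r') \<le> R ^ DIM('a) * (B R * V)" if R: "R > 0" for R
  proof -
    define g where "g p = \<kappa>' (p /\<^sub>R R) / of_real R * r p + \<kappa> (p /\<^sub>R R) * r' p" for p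
    have g_eq: "integral (cball 0 R) r' = integral (cball 0 R) g"
      unfolding g_def by (rule integral_cball_cutoff[OF r R])
    have cg: "continuous_on UNIV g"
      using rescaled_product[OF r R] by (simp add: C1_dir_on_def g_def[abs_def])
    have cg': "continuous_on (cball 0 1) (\<lambda>p. g (R *\<^sub>R p))"
      by (rule continuous_on_compose2[OF cg]) (auto intro!: continuous_intros)
    \<comment> \<open>Rescaling to the unit ball evaluates \<open>\<kappa>\<close> and
      \<open>\<kappa>'\<close> only where the bounds \<open>M\<close> and \<open>M'\<close>
      apply.\<close>
    have scale: "integral (cball 0 R) g = of_real R ^ DIM('a) * integral (cball 0 1) (\<lambda>p. g (R *\<^sub>R p))"
      using integral_scaled_cball[OF integrable_continuous_cball[OF cg'] R] R by simp
    have B0: "0 \<le> B R"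
      using R M M' \<open>0 \<le> C\<close> \<open>0 \<le> C'\<close> by (simp add: B_def)
    have "norm (g (R *\<^sub>R p)) \<le> B R" if p: "p \<in> cball 0 1" for p
    proof (cases "norm p < 1/2")
      case True
      then show ?thesis using B0 R by (simp add: g_def chi_0 chi'_0)
    next
      case False
      have "R * (1/2) \<le> R * norm p" using False R by (intro mult_left_mono) auto
      then have le: "R / 2 \<le> 1 + norm (R *\<^sub>R p)" using R unfolding norm_scaleR by linarith
      have "norm (r (R *\<^sub>R p)) \<le> C * (1 + norm (R *\<^sub>R p)) powr m" by (rule bound)
      also have "\<dots> \<le> C * (R / 2) powr m"
        using le R m0 \<open>0 \<le> C\<close> by (intro mult_left_mono powr_mono2') auto
      finally have 1: "norm (r (R *\<^sub>R p)) \<le> C * (R / 2) powr m" .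
      have "norm (r' (R *\<^sub>R p)) \<le> C' * (1 + norm (R *\<^sub>R p)) powr (m - 1)" by (rule bound')
      also have "\<dots> \<le> C' * (R / 2) powr (m - 1)"
        using le R m0 \<open>0 \<le> C'\<close> by (intro mult_left_mono powr_mono2') auto
      finally have 2: "norm (r' (R *\<^sub>R p)) \<le> C' * (R / 2) powr (m - 1)" .
      have "norm (g (R *\<^sub>R p)) \<le> norm (\<kappa>' p) / R * norm (r (R *\<^sub>R p)) + norm (\<kappa> p) * norm (r' (R *\<^sub>R p))"
        unfolding g_def using R
        by (intro order_trans[OF norm_triangle_ineq]) (simp add: norm_mult norm_divide)
      also have "\<dots> \<le> B R"
        unfolding B_def using M(2)[of p] M'(2)[of p] M(1) M'(1) 1 2 R p
        by (intro add_mono mult_mono divide_right_mono) auto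
      finally show ?thesis .
    qed
    then have "norm (integral (cball 0 1) (\<lambda>p. g (R *\<^sub>R p))) \<le> integral (cball (0::'a) 1) (\<lambda>_. B R)"
      by (intro integral_norm_bound_integral integrable_continuous_cball cg')
         (auto intro: integrable_on_const lmeasurable_cball)
    also have "\<dots> = B R * V"
      unfolding V_def by (simp flip: integral_mult_right)
    finally show ?thesis
      unfolding g_eq scale using R by (simp add: norm_mult norm_power mult_left_mono)
  qed
  define K where "K = M' * C / 2 powr m + M * C' / 2 powr (m - 1)"
  have eq: "R ^ DIM('a) * (B R * V) = K * V * R powr (m - 1 + real DIM('a))" if "R > 0" for R
  proof -
    have "R powr (m - 1) = R powr m / R" using that by (simp add: powr_diff)
    moreover have "R powr (m - 1 + real DIM('a)) = R powr (m - 1) * R ^ DIM('a)"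
      using that by (simp add: powr_add powr_realpow)
    ultimately show ?thesis
      using that unfolding B_def K_def by (simp add: powr_divide field_simps)
  qed
  have "((\<lambda>R. R powr (m - 1 + real DIM('a))) \<longlongrightarrow> 0) at_top"
    using m by (intro tendsto_neg_powr filterlim_ident) simp
  from tendsto_mult_left[OF this, of "K * V"]
  have "((\<lambda>R. K * V * R powr (m - 1 + real DIM('a))) \<longlongrightarrow> 0) at_top" by simp
  then show ?thesis
    by (rule Lim_null_comparison[rotated])
       (use eventually_gt_at_top[of 0] in eventually_elim, use est eq in force)
qed

end

subsection \<open>Asymptotic expansions\<close>

text \<open>The constant term for an arbitrary function of the radius, so that expansions can be
  combined apart from integrals.\<close>

definition expansion_const :: "(real \<Rightarrow> complex) \<Rightarrow> complex \<Rightarrow> bool" where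
  "expansion_const F c \<longleftrightarrow>
     (\<exists>(E :: complex set) a b. finite E \<and> 0 \<notin> E \<and>
        ((\<lambda>R. F R - (\<Sum>e\<in>E. a e * of_real R powr e) - b * of_real (ln R)) \<longlongrightarrow> c) at_top)"

lemma has_cutoff_integral_iff:
  "has_cutoff_integral f c \<longleftrightarrow> expansion_const (\<lambda>R. integral (cball 0 R) f) c"
  by (simp add: has_cutoff_integral_def expansion_const_def)

lemma expansion_const_tendsto:
  assumes "(F \<longlongrightarrow> c) at_top"
  shows "expansion_const F c"
  unfolding expansion_const_def using assms
  by (intro exI[of _ "{}"] exI[of _ "\<lambda>_. 0"] exI[of _ 0]) simp

lemma expansion_const_powr:
  assumes "e \<noteq> 0"
  shows "expansion_const (\<lambda>R. of_real R powr e) 0"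
  unfolding expansion_const_def using assms
  by (intro exI[of _ "{e}"] exI[of _ "\<lambda>_. 1"] exI[of _ 0]) simp

lemma expansion_const_cmult:
  assumes "expansion_const F c"
  shows "expansion_const (\<lambda>R. k * F R) (k * c)"
proof -
  obtain E a b where E: "finite E" "0 \<notin> E"
    "((\<lambda>R. F R - (\<Sum>e\<in>E. a e * of_real R powr e) - b * of_real (ln R)) \<longlongrightarrow> c) at_top"
    using assms unfolding expansion_const_def by blast
  from tendsto_mult_left[OF E(3), of k] show ?thesis
    unfolding expansion_const_def using E(1,2)
    by (intro exI[of _ E] exI[of _ "\<lambda>e. k * a e"] exI[of _ "k * b"])
       (simp add: algebra_simps sum_distrib_left)
qed

lemma expansion_const_add:
  assumes "expansion_const F c" "expansion_const G d"
  shows "expansion_const (\<lambda>R. F R + G R) (c + d)"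
proof -
  obtain E a b where E: "finite E" "0 \<notin> E"
    "((\<lambda>R. F R - (\<Sum>e\<in>E. a e * of_real R powr e) - b * of_real (ln R)) \<longlongrightarrow> c) at_top"
    using assms(1) unfolding expansion_const_def by blast
  obtain E' a' b' where E': "finite E'" "0 \<notin> E'"
    "((\<lambda>R. G R - (\<Sum>e\<in>E'. a' e * of_real R powr e) - b' * of_real (ln R)) \<longlongrightarrow> d) at_top"
    using assms(2) unfolding expansion_const_def by blast
  \<comment> \<open>Coefficients are padded by zero to the union of the two exponent sets; common
    exponents add up.\<close>
  define A where "A e = (if e \<in> E then a e else 0) + (if e \<in> E' then a' e else 0)" for e
  have "(\<Sum>e\<in>E \<union> E'. A e * of_real R powr e)
     = (\<Sum>e\<in>E. a e * of_real R powr e) + (\<Sum>e\<in>E'. a' e * of_real R powr e)" for R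
  proof -
    have "(\<Sum>e\<in>E \<union> E'. A e * of_real R powr e)
      = (\<Sum>e\<in>E \<union> E'. if e \<in> E then a e * of_real R powr e else 0)
        + (\<Sum>e\<in>E \<union> E'. if e \<in> E' then a' e * of_real R powr e else 0)"
      unfolding sum.distrib[symmetric] by (intro sum.cong) (auto simp: A_def algebra_simps)
    also have "\<dots> = (\<Sum>e\<in>E. a e * of_real R powr e) + (\<Sum>e\<in>E'. a' e * of_real R powr e)"
      using E(1) E'(1) by (simp add: sum.inter_restrict[symmetric] Int_absorb1)
    finally show ?thesis .
  qed
  with tendsto_add[OF E(3) E'(3)] show ?thesis
    unfolding expansion_const_def using E(1,2) E'(1,2)
    by (intro exI[of _ "E \<union> E'"] exI[of _ A] exI[of _ "b + b'"]) (simp add: algebra_simps)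
qed

lemma expansion_const_sum:
  assumes "\<And>i. i \<in> I \<Longrightarrow> expansion_const (F i) (c i)"
  shows "expansion_const (\<lambda>R. \<Sum>i\<in>I. F i R) (\<Sum>i\<in>I. c i)"
  using assms
proof (induction I rule: infinite_finite_induct)
  case (insert i I)
  then show ?case by (simp add: expansion_const_add)
qed (auto intro: expansion_const_tendsto)

text \<open>Needed because the formula for homogeneous components holds only from R = 2 on.\<close>

lemma expansion_const_cong:
  assumes "\<forall>\<^sub>F R in at_top. F R = G R"
  shows "expansion_const F c \<longleftrightarrow> expansion_const G c"
proof -
  have "((\<lambda>R. F R - (\<Sum>e\<in>E. a e * of_real R powr e) - b * of_real (ln R)) \<longlongrightarrow> c) at_top \<longleftrightarrow>
    ((\<lambda>R. G R - (\<Sum>e\<in>E. a e * of_real R powr e) - b * of_real (ln R)) \<longlongrightarrow> c) at_top" for E a b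
    by (rule tendsto_cong) (use assms in eventually_elim, simp)
  then show ?thesis unfolding expansion_const_def by simp
qed

text \<open>The operator \<open>g \<mapsto> g (s + h) - exp (e h) g s\<close> annihilates \<open>exp (e s)\<close>; this also handles purely
  imaginary exponents, whose exponentials oscillate without decaying.\<close>

lemma exp_sum_tendsto_zero:
  assumes "finite E" "0 \<notin> E"
    and "((\<lambda>s. (\<Sum>e\<in>E. a e * exp (e * of_real s)) + b * of_real s + c) \<longlongrightarrow> 0) at_top"
  shows "b = 0 \<and> c = (0 :: complex)"
  using assms
proof (induction E arbitrary: a b c rule: finite_induct)
  case empty
  then have lim: "((\<lambda>s. b * of_real s + c) \<longlongrightarrow> 0) at_top" by simp
  \<comment> \<open>Subtracting the unshifted function from its shift by 1 isolates the slope
    \<open>b\<close>.\<close>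
  have "((\<lambda>s. b * of_real (s + 1) + c) \<longlongrightarrow> 0) at_top"
    using filterlim_compose[OF lim filterlim_tendsto_add_at_top[OF tendsto_const filterlim_ident], of 1]
    by (simp add: add.commute)
  from tendsto_diff[OF this lim] have "((\<lambda>s::real. b) \<longlongrightarrow> 0) at_top"
    by (simp add: algebra_simps)
  then have "b = 0" by (simp add: tendsto_const_iff)
  with lim show ?case by (simp add: tendsto_const_iff)
next
  case (insert e E)
  \<comment> \<open>With this step \<open>e * h\<close> has modulus 1, so it is no multiple of 2 pi
    i and \<open>q\<close> differs from 1.\<close>
  define h where "h = 1 / cmod e"
  define q where "q = exp (e * of_real h)"
  have "e \<noteq> 0" using insert.prems by auto
  have "q \<noteq> 1"
  proof
    assume "q = 1"
    then obtain n :: int where n: "Re (e * of_real h) = 0" "Im (e * of_real h) = of_int (2 * n) * pi"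
      unfolding q_def exp_eq_1 by auto
    have "cmod (e * of_real h) = 1" using \<open>e \<noteq> 0\<close> by (simp add: h_def norm_mult norm_divide)
    then have 1: "\<bar>of_int (2 * n) * pi\<bar> = 1"
      using cmod_eq_Im[OF n(1)] n(2) by simp
    then have "n \<noteq> 0" by auto
    then have "1 \<le> \<bar>real_of_int (2 * n)\<bar>" by linarith
    then have "pi \<le> \<bar>of_int (2 * n) * pi\<bar>" by (simp add: abs_mult)
    then show False using 1 pi_gt3 by linarith
  qed
  define g where "g s = (\<Sum>e\<in>insert e E. a e * exp (e * of_real s)) + b * of_real s + c" for s
  have lim: "(g \<longlongrightarrow> 0) at_top" using insert.prems by (simp add: g_def[abs_def])
  have "((\<lambda>s. g (s + h)) \<longlongrightarrow> 0) at_top"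
    using filterlim_compose[OF lim filterlim_tendsto_add_at_top[OF tendsto_const filterlim_ident], of h]
    by (simp add: add.commute)
  from tendsto_diff[OF this tendsto_mult_left[OF lim, of q]]
  have lim': "((\<lambda>s. g (s + h) - q * g s) \<longlongrightarrow> 0) at_top" by simp
  \<comment> \<open>The coefficient of the exponent \<open>e\<close> becomes 0, and the affine part
    stays affine with slope multiplied by 1 - q. The induction hypothesis thus applies, and q
    \<noteq> 1 recovers first \<open>b\<close> and then \<open>c\<close>.\<close>
  have eq: "g (s + h) - q * g s = (\<Sum>f\<in>E. (a f * (exp (f * of_real h) - q)) * exp (f * of_real s))
      + (b * (1 - q)) * of_real s + (b * of_real h + c * (1 - q))" for s
  proof -
    have "g (s + h) - q * g s = (\<Sum>f\<in>insert e E. a f * exp (f * of_real (s + h)))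
       - (\<Sum>f\<in>insert e E. q * (a f * exp (f * of_real s)))
      + (b * (1 - q)) * of_real s + (b * of_real h + c * (1 - q))"
      by (simp add: g_def algebra_simps sum_distrib_left del: sum.insert)
    also have "(\<Sum>f\<in>insert e E. a f * exp (f * of_real (s + h)))
       - (\<Sum>f\<in>insert e E. q * (a f * exp (f * of_real s)))
       = (\<Sum>f\<in>insert e E. (a f * (exp (f * of_real h) - q)) * exp (f * of_real s))"
      unfolding sum_subtractf[symmetric]
      by (intro sum.cong refl) (simp add: algebra_simps exp_add)
    also have "\<dots> = (\<Sum>f\<in>E. (a f * (exp (f * of_real h) - q)) * exp (f * of_real s))"
      using insert.hyps by (simp add: q_def)
    finally show ?thesis .
  qed
  have "b * (1 - q) = 0 \<and> b * of_real h + c * (1 - q) = 0"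
    by (rule insert.IH) (use insert.prems lim' in \<open>simp_all add: eq\<close>)
  then show ?case using \<open>q \<noteq> 1\<close> by auto
qed

text \<open>Justifies the definite description in \<open>cutoff_integral\<close>. The difference of
  two expansions of \<open>F\<close> is an expansion of 0 with constant
  \<open>c - d\<close>.\<close>

lemma expansion_const_unique:
  assumes "expansion_const F c" "expansion_const F d"
  shows "c = d"
proof -
  have "expansion_const (\<lambda>R. F R + (-1) * F R) (c + (-1) * d)"
    using assms by (intro expansion_const_add expansion_const_cmult)
  then obtain E a b where E: "finite E" "0 \<notin> E"
    "((\<lambda>R. - (\<Sum>e\<in>E. a e * of_real R powr e) - b * of_real (ln R)) \<longlongrightarrow> c - d) at_top"
    unfolding expansion_const_def by auto
  \<comment> \<open>The substitution R = exp s turns powers into exponentials and the logarithm into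
    a linear term.\<close>
  have "((\<lambda>s. - (\<Sum>e\<in>E. a e * of_real (exp s) powr e) - b * of_real (ln (exp s))) \<longlongrightarrow> c - d) at_top"
    by (rule filterlim_compose[OF E(3) exp_at_top])
  then have "((\<lambda>s. - (\<Sum>e\<in>E. a e * exp (e * of_real s)) - b * of_real s) \<longlongrightarrow> c - d) at_top"
    by (simp add: powr_def Ln_of_real flip: exp_of_real)
  from tendsto_diff[OF tendsto_const[of "c - d"] this] 
  have "((\<lambda>s. (\<Sum>e\<in>E. a e * exp (e * of_real s)) + b * of_real s + (c - d)) \<longlongrightarrow> 0) at_top"
    by (simp add: algebra_simps)
  from exp_sum_tendsto_zero[OF E(1,2) this] show ?thesis by simp
qed

lemma cutoff_integral_eqI:
  assumes "has_cutoff_integral f c"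
  shows "cutoff_integral f = c"
  unfolding cutoff_integral_def using assms expansion_const_unique
  by (auto simp: has_cutoff_integral_iff)

subsection \<open>Cut-off integrals of fibre derivatives\<close>

lemma smooth_on_differentiable_at:
  assumes "smooth_on S f" "open S" "p \<in> S"
  shows "f differentiable (at p)"
proof -
  have "Ck_on (Suc 0) S f" using assms(1) unfolding smooth_on_def by blast
  then show ?thesis using assms(2,3) by (simp add: differentiable_on_eq_differentiable_at)
qed

lemma dxi_dir_in_Basis: "dxi_dir j \<in> Basis"
  by (auto simp: dxi_dir_def Basis_prod_def axis_in_Basis_iff)

text \<open>Bridge from joint smoothness to the one-direction calculus: the Frechet derivative is
  composed with the line through (x, p) in direction \<open>dxi_dir j\<close>.\<close>

lemma smooth_on_fibre:
  fixes f :: "'n::finite symb"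
  assumes f: "smooth_on (U \<times> T) f" and "open U" "open T" "x \<in> U"
  shows "C1_dir_on T (axis j 1) (\<lambda>\<xi>. f (x, \<xi>)) (\<lambda>\<xi>. pd (dxi_dir j) f (x, \<xi>))"
proof -
  have op: "open (U \<times> T)" using assms by (intro open_Times)
  have "Ck_on 0 (U \<times> T) f" "Ck_on (Suc 0) (U \<times> T) f"
    using f unfolding smooth_on_def by blast+
  then have cont: "continuous_on (U \<times> T) f" "continuous_on (U \<times> T) (pd (dxi_dir j) f)"
    using dxi_dir_in_Basis by auto
  have fib: "continuous_on T (\<lambda>\<xi>. g (x, \<xi>))" if "continuous_on (U \<times> T) g" for g :: "'n symb"
    by (rule continuous_on_compose2[OF that]) (use assms in \<open>auto intro!: continuous_intros\<close>)
  have "((\<lambda>t. f (x, p + t *\<^sub>R axis j 1)) has_vector_derivative pd (dxi_dir j) f (x, p)) (at 0)"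
    if "p \<in> T" for p
  proof -
    have "(f has_derivative frechet_derivative f (at (x, p))) (at (x, p))"
      using smooth_on_differentiable_at[OF f op, of "(x, p)"] assms that
      by (simp add: frechet_derivative_works)
    then have "(f has_derivative frechet_derivative f (at (x, p)))
        (at ((\<lambda>t. (x, p) + t *\<^sub>R dxi_dir j) 0) within range (\<lambda>t. (x, p) + t *\<^sub>R dxi_dir j))"
      by (auto intro: has_derivative_at_withinI)
    moreover have "((\<lambda>t. (x, p) + t *\<^sub>R dxi_dir j) has_vector_derivative dxi_dir j) (at 0)"
      by (auto intro!: derivative_eq_intros simp: has_vector_derivative_def)
    ultimately have "(f \<circ> (\<lambda>t. (x, p) + t *\<^sub>R dxi_dir j) has_vector_derivative
        frechet_derivative f (at (x, p)) (dxi_dir j)) (at 0)"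
      by (intro vector_derivative_diff_chain_within)
    then show ?thesis by (simp add: o_def pd_def dxi_dir_def)
  qed
  then show ?thesis using fib[OF cont(1)] fib[OF cont(2)] by (simp add: C1_dir_on_def)
qed

lemma symbols_bound:
  assumes "\<sigma> \<in> symbols U m" "x \<in> U"
  shows "\<exists>C. \<forall>\<xi>. norm (\<sigma> (x, \<xi>)) \<le> C * (1 + norm \<xi>) powr m"
    and "\<exists>C. \<forall>\<xi>. norm (pd (dxi_dir j) \<sigma> (x, \<xi>)) \<le> C * (1 + norm \<xi>) powr (m - 1)"
proof -
  have *: "\<exists>C. \<forall>\<xi>. norm (pds (map dxi_dir js) \<sigma> (x, \<xi>)) \<le> C * (1 + norm \<xi>) powr (m - real (length js))" for js
  proof -
    \<comment> \<open>Symbol estimates are uniform on compact sets of base points; a single point is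
      one.\<close>
    have "compact {x} \<and> {x} \<subseteq> U" using assms(2) by simp
    then obtain C where "\<forall>y\<in>{x}. \<forall>\<xi>. norm (pds (map dx_dir [] @ map dxi_dir js) \<sigma> (y, \<xi>))
               \<le> C * (1 + norm \<xi>) powr (m - real (length js))"
      using assms(1) unfolding symbols_def by blast
    then show ?thesis by auto
  qed
  show "\<exists>C. \<forall>\<xi>. norm (\<sigma> (x, \<xi>)) \<le> C * (1 + norm \<xi>) powr m"
    using *[of "[]"] by (simp add: pds_def)
  show "\<exists>C. \<forall>\<xi>. norm (pd (dxi_dir j) \<sigma> (x, \<xi>)) \<le> C * (1 + norm \<xi>) powr (m - 1)"
    using *[of "[j]"] by (simp add: pds_def)
qed

lemma excision_function_radial_cutoff:
  assumes "excision_function U \<psi>" "open U" "x \<in> U"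
  shows "radial_cutoff (axis j 1) (\<lambda>\<xi>. \<psi> (x, \<xi>)) (\<lambda>\<xi>. pd (dxi_dir j) \<psi> (x, \<xi>))"
  using assms by unfold_locales (auto simp: excision_function_def intro: smooth_on_fibre)

lemma holomorphic_family_smooth_on:
  assumes "holomorphic_family U \<psi> W \<alpha> \<tau>" "z \<in> W"
  shows "smooth_on (U \<times> UNIV) (\<tau> z)"
  using assms
  by (auto simp: holomorphic_family_def CSm_com_def classical_symbols_def symbols_def)

text \<open>The component of index \<open>k\<close> contributes, for R \<ge> 2, a multiple of R to
  the power \<alpha> z - k - 1 + n. This exponent is nonzero as \<alpha> z is no integer, and the
  remainder contributes o(1).\<close>

lemma holomorphic_family_expansion:
  fixes U :: "(real ^ 'n::finite) set"
  assumes fam: "holomorphic_family U \<psi> W \<alpha> \<tau>" and z: "z \<in> W" and int: "\<alpha> z \<notin> \<int>"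
    and \<psi>: "excision_function U \<psi>" and U: "open U" "x \<in> U"
  shows "has_cutoff_integral (\<lambda>\<xi>. pd (dxi_dir j) (\<tau> z) (x, \<xi>)) 0"
proof -
  interpret radial_cutoff "axis j 1" "\<lambda>\<xi>. \<psi> (x, \<xi>)" "\<lambda>\<xi>. pd (dxi_dir j) \<psi> (x, \<xi>)"
    by (rule excision_function_radial_cutoff[OF \<psi> U])
  obtain s where hom: "\<And>k. homogeneous_symbol U (\<alpha> z - of_nat k) (s k z)"
    and rem: "\<And>N. N \<ge> 1 \<Longrightarrow> (\<forall>k. \<forall>\<epsilon>>0. \<forall>z\<in>W.
        (\<lambda>p. (deriv ^^ k) (\<lambda>w. \<tau> w p - (\<Sum>j<N. \<psi> p * s j w p)) z) \<in> symbols U (Re (\<alpha> z) - real N + \<epsilon>))"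
    using fam z unfolding holomorphic_family_def Let_def by blast
  \<comment> \<open>With \<epsilon> = 1 below, the remainder has order \<open>m\<close> = Re
    (\<alpha> z) - N0 < -n.\<close>
  obtain N0 :: nat where N0: "real N0 > Re (\<alpha> z) + real CARD('n)"
    using reals_Archimedean2 by blast
  define N where "N = Suc N0"
  define m where "m = Re (\<alpha> z) - real N + 1"
  have m: "m < 1 - real DIM(real ^ 'n)" using N0 by (simp add: m_def N_def)
  define r where "r p = \<tau> z p - (\<Sum>k<N. \<psi> p * s k z p)" for p
  have r: "r \<in> symbols U m"
  proof -
    have "1 \<le> N" by (simp add: N_def)
    \<comment> \<open>The z-derivative of order 0 is the remainder itself.\<close>
    from rem[OF this, THEN spec, of 0, THEN spec, of 1] z
    have "(\<lambda>p. \<tau> z p - (\<Sum>k<N. \<psi> p * s k z p)) \<in> symbols U m"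
      by (simp add: m_def)
    then show ?thesis by (simp add: r_def[abs_def])
  qed
  define d where "d k \<xi> = pd (dxi_dir j) \<psi> (x, \<xi>) * s k z (x, \<xi>) + \<psi> (x, \<xi>) * pd (dxi_dir j) (s k z) (x, \<xi>)" for k \<xi>
  have C1s: "C1_dir_on (- {0}) (axis j 1) (\<lambda>\<xi>. s k z (x, \<xi>)) (\<lambda>\<xi>. pd (dxi_dir j) (s k z) (x, \<xi>))" for k
    using hom[of k] U by (intro smooth_on_fibre[of U]) (auto simp: homogeneous_symbol_def Compl_eq_Diff_UNIV)
  have C1d: "C1_dir_on UNIV (axis j 1) (\<lambda>\<xi>. \<psi> (x, \<xi>) * s k z (x, \<xi>)) (d k)" for k
    unfolding d_def[abs_def] by (rule product_punctured[OF C1s])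
  have C1r: "C1_dir_on UNIV (axis j 1) (\<lambda>\<xi>. r (x, \<xi>)) (\<lambda>\<xi>. pd (dxi_dir j) r (x, \<xi>))"
    using r U by (intro smooth_on_fibre[of U]) (auto simp: symbols_def)
  have C1t: "C1_dir_on UNIV (axis j 1) (\<lambda>\<xi>. \<tau> z (x, \<xi>)) (\<lambda>\<xi>. pd (dxi_dir j) (\<tau> z) (x, \<xi>))"
    using U by (intro smooth_on_fibre[of U] holomorphic_family_smooth_on[OF fam z]) auto
  \<comment> \<open>A second formula for the derivative of \<open>\<tau> z\<close> on the fibre;
    uniqueness then splits the integrand.\<close>
  have "C1_dir_on UNIV (axis j 1) (\<lambda>\<xi>. (\<Sum>k<N. \<psi> (x, \<xi>) * s k z (x, \<xi>)) + r (x, \<xi>))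
      (\<lambda>\<xi>. (\<Sum>k<N. d k \<xi>) + pd (dxi_dir j) r (x, \<xi>))"
    by (intro C1_dir_on_add C1_dir_on_sum C1d C1r)
  then have "C1_dir_on UNIV (axis j 1) (\<lambda>\<xi>. \<tau> z (x, \<xi>))
      (\<lambda>\<xi>. (\<Sum>k<N. d k \<xi>) + pd (dxi_dir j) r (x, \<xi>))"
    by (simp add: r_def)
  from C1_dir_on_unique[OF C1t this]
  have decomp: "pd (dxi_dir j) (\<tau> z) (x, \<xi>) = (\<Sum>k<N. d k \<xi>) + pd (dxi_dir j) r (x, \<xi>)" for \<xi>
    by simp
  have int_d: "d k integrable_on cball 0 R" for k R
    using C1d[of k] by (auto simp: C1_dir_on_def intro: integrable_continuous_cball continuous_on_subset)
  have int_r: "(\<lambda>\<xi>. pd (dxi_dir j) r (x, \<xi>)) integrable_on cball 0 R" for R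
    using C1r by (auto simp: C1_dir_on_def intro: integrable_continuous_cball continuous_on_subset)
  have eq: "integral (cball 0 R) (\<lambda>\<xi>. pd (dxi_dir j) (\<tau> z) (x, \<xi>))
     = (\<Sum>k<N. integral (cball 0 R) (d k)) + integral (cball 0 R) (\<lambda>\<xi>. pd (dxi_dir j) r (x, \<xi>))" for R
    unfolding decomp by (simp add: integral_add integrable_sum int_d int_r integral_sum)
  have "expansion_const (\<lambda>R. integral (cball 0 R) (d k)) 0" for k
  proof -
    define e where "e = \<alpha> z - of_nat k - 1 + of_nat DIM(real ^ 'n)"
    have "e \<noteq> 0"
    proof
      assume "e = 0"
      then have "\<alpha> z = of_int (int k + 1 - int DIM(real ^ 'n))" by (simp add: e_def algebra_simps)
      then show False using int by (metis Ints_of_int)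
    qed
    then have "expansion_const (\<lambda>R. integral (cball 0 1) (d k) * of_real R powr e) (integral (cball 0 1) (d k) * 0)"
      by (intro expansion_const_cmult expansion_const_powr)
    moreover have "\<forall>\<^sub>F R in at_top. integral (cball 0 R) (d k) = integral (cball 0 1) (d k) * of_real R powr e"
      using eventually_ge_at_top[of 2]
    proof eventually_elim
      case (elim R)
      show ?case unfolding d_def[abs_def] e_def
        by (rule integral_homogeneous[OF C1s _ elim]) (use hom[of k] U in \<open>auto simp: homogeneous_symbol_def\<close>)
    qed
    ultimately show ?thesis using expansion_const_cong by simp
  qed
  then have "expansion_const (\<lambda>R. \<Sum>k<N. integral (cball 0 R) (d k)) (\<Sum>k<N. 0)"
    by (intro expansion_const_sum)
  moreover have "expansion_const (\<lambda>R. integral (cball 0 R) (\<lambda>\<xi>. pd (dxi_dir j) r (x, \<xi>))) 0"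
  proof (rule expansion_const_tendsto)
    from symbols_bound[OF r U(2)] obtain C C' where
      "\<And>\<xi>. norm (r (x, \<xi>)) \<le> C * (1 + norm \<xi>) powr m"
      "\<And>\<xi>. norm (pd (dxi_dir j) r (x, \<xi>)) \<le> C' * (1 + norm \<xi>) powr (m - 1)" by metis
    then show "((\<lambda>R. integral (cball 0 R) (\<lambda>\<xi>. pd (dxi_dir j) r (x, \<xi>))) \<longlongrightarrow> 0) at_top"
      using C1r m by (intro integral_remainder_tendsto_0)
  qed
  ultimately have "expansion_const (\<lambda>R. (\<Sum>k<N. integral (cball 0 R) (d k))
     + integral (cball 0 R) (\<lambda>\<xi>. pd (dxi_dir j) r (x, \<xi>))) ((\<Sum>k<N. 0) + 0)"
    by (rule expansion_const_add)
  then show ?thesis by (simp add: has_cutoff_integral_iff eq)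
qed

lemma has_cutoff_integral_lincomb:
  fixes f :: "'i \<Rightarrow> real ^ 'n::finite \<Rightarrow> complex"
  assumes "\<And>i. i \<in> I \<Longrightarrow> continuous_on UNIV (f i)"
    and "\<And>i. i \<in> I \<Longrightarrow> has_cutoff_integral (f i) 0"
  shows "has_cutoff_integral (\<lambda>\<xi>. \<Sum>i\<in>I. c i * f i \<xi>) 0"
proof (cases "finite I")
  case True
  have "expansion_const (\<lambda>R. \<Sum>i\<in>I. c i * integral (cball 0 R) (f i)) (\<Sum>i\<in>I. c i * 0)"
    using assms(2) by (intro expansion_const_sum expansion_const_cmult) (simp add: has_cutoff_integral_iff)
  moreover have "integral (cball 0 R) (\<lambda>\<xi>. \<Sum>i\<in>I. c i * f i \<xi>) = (\<Sum>i\<in>I. c i * integral (cball 0 R) (f i))" for R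
  proof -
    have "(\<lambda>\<xi>. c i * f i \<xi>) integrable_on cball 0 R" if "i \<in> I" for i
      using assms(1)[OF that]
      by (intro integrable_continuous_cball continuous_intros) (auto intro: continuous_on_subset)
    then show ?thesis using True by (simp add: integral_sum)
  qed
  ultimately show ?thesis by (simp add: has_cutoff_integral_iff)
\<comment> \<open>Over an infinite index set the sum is 0 by convention.\<close>
qed (auto simp: has_cutoff_integral_iff intro!: expansion_const_tendsto)

section \<open>Exceptional parameters\<close>

text \<open>The sine gathers all integer values of \<alpha> into the zeros of one holomorphic
  function. Were it identically 0, its derivative at \<open>w\<close> would force the cosine to
  vanish together with the sine. On a connected set its zeros are therefore isolated.\<close>

lemma cosparse_not_Ints:
  assumes "\<alpha> holomorphic_on W" "open W" "connected W" "w \<in> W" "deriv \<alpha> w \<noteq> 0"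
  shows "\<forall>\<^sub>\<approx>z\<in>W. \<alpha> z \<notin> \<int>"
proof -
  define f where "f z = sin (of_real pi * \<alpha> z)" for z
  have hol: "f holomorphic_on W"
    unfolding f_def[abs_def] by (intro holomorphic_intros assms)
  have f0: "f z = 0" if "\<alpha> z \<in> \<int>" for z
    using that by (auto elim!: Ints_cases simp: f_def sin_eq_0 mult.commute)
  have "\<exists>y\<in>W. f y \<noteq> 0"
  proof (rule ccontr)
    assume "\<not> ?thesis"
    then have z: "f y = 0" if "y \<in> W" for y using that by blast
    have "(\<alpha> has_field_derivative deriv \<alpha> w) (at w)"
      using assms holomorphic_derivI by blast
    then have "(f has_field_derivative cos (of_real pi * \<alpha> w) * (of_real pi * deriv \<alpha> w)) (at w)"
      unfolding f_def[abs_def] by (auto intro!: derivative_eq_intros)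
    moreover have "(f has_field_derivative 0) (at w)"
      by (rule has_field_derivative_transform_within_open[of "\<lambda>_. 0" _ _ W])
         (use assms(2,4) z in auto)
    ultimately have "cos (of_real pi * \<alpha> w) = 0"
      using DERIV_unique assms(5) by fastforce
    then show False
      using z[OF assms(4)] sin_cos_squared_add[of "of_real pi * \<alpha> w"] by (simp add: f_def)
  qed
  then obtain y where y: "y \<in> W" "f y \<noteq> 0" by blast
  have "\<forall>\<^sub>F z in at u. \<alpha> z \<notin> \<int>" if u: "u \<in> W" for u
  proof -
    have "\<forall>\<^sub>F z in at u. f z \<noteq> 0 \<and> z \<in> W"
      by (rule non_zero_neighbour_alt[OF hol assms(2,3) u y])
    then show ?thesis by eventually_elim (use f0 in auto)
  qed
  then show ?thesis using assms(2) by (simp add: eventually_cosparse_open_eq)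
qed

section \<open>From symbols to forms\<close>

lemma CS_com_sum:
  assumes "finite A" "A \<noteq> {}" "\<And>a. a \<in> A \<Longrightarrow> f a \<in> CS_com U \<psi>"
  shows "(\<lambda>p. \<Sum>a\<in>A. f a p) \<in> CS_com U \<psi>"
  using assms by (induction A rule: finite_ne_induct) (auto intro: CS_com.add)

text \<open>\<open>R\<close> is specified on \<open>CS_com\<close> only, so coefficients must lie
  there. Those of a wedge product are finite sums of products, whence the algebra rather than a
  single \<open>CSm_com\<close>.\<close>

lemma Omega_CS_com_coefficient:
  assumes "\<omega> \<in> Omega_CS_com U \<psi>"
  shows "\<omega> I J \<in> CS_com U \<psi>"
  using assms
proof (induction arbitrary: I J rule: Omega_CS_com.induct)
  case (base \<omega> m)
  then show ?case by (auto simp: symbol_forms_of_order_def intro: CS_com.base)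
next
  case (scale \<omega> c)
  then show ?case by (intro CS_com.scale)
next
  case (add \<omega> \<eta>)
  then show ?case by (intro CS_com.add)
next
  case (wedge \<omega> \<eta>)
  have "(\<lambda>p. \<Sum>I'\<in>Pow I. \<Sum>J'\<in>Pow J. 
     (-1) ^ (card J' * card (I - I')) * shuffle_sign I' (I - I') * shuffle_sign J' (J - J')
       * \<omega> I' J' p * \<eta> (I - I') (J - J') p) \<in> CS_com U \<psi>"
    by (intro CS_com_sum CS_com.mult CS_com.scale wedge.IH) auto
  then show ?case by (simp add: wedge_def[abs_def])
qed

text \<open>Finitely many families represent the regularised symbol, each with its own sparse
  exceptional set. Off the union of these sets all cut-off integrals vanish, and derivatives add up.
  Continuity is recorded for later linear combinations.\<close>

lemma regularisation_expansion:
  fixes U :: "(real ^ 'n::finite) set"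
  assumes R: "holomorphic_regularisation U \<psi> W R" and \<sigma>: "\<sigma> \<in> CS_com U \<psi>"
    and \<psi>: "excision_function U \<psi>" and U: "open U" "x \<in> U"
    and W: "open W" "connected W" "0 \<in> W"
  shows "\<forall>\<^sub>\<approx>z\<in>W. \<forall>j. continuous_on UNIV (\<lambda>\<xi>. pd (dxi_dir j) (R \<sigma> z) (x, \<xi>)) \<and>
    has_cutoff_integral (\<lambda>\<xi>. pd (dxi_dir j) (R \<sigma> z) (x, \<xi>)) 0"
proof -
  obtain k \<alpha> \<tau> where fam: "\<And>i. i < (k::nat) \<Longrightarrow> holomorphic_family U \<psi> W (\<alpha> i) (\<tau> i)"
    and der: "\<And>i. i < k \<Longrightarrow> deriv (\<alpha> i) 0 \<noteq> 0"
    and sum: "\<And>z p. z \<in> W \<Longrightarrow> R \<sigma> z p = (\<Sum>i<k. \<tau> i z p)"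
    using R \<sigma> unfolding holomorphic_regularisation_def by metis
  have "\<forall>\<^sub>\<approx>z\<in>W. \<alpha> i z \<notin> \<int>" if "i < k" for i
    using fam[OF that] der[OF that] W
    by (intro cosparse_not_Ints) (auto simp: holomorphic_family_def)
  then have "\<forall>\<^sub>\<approx>z\<in>W. \<forall>i\<in>{..<k}. \<alpha> i z \<notin> \<int>"
    by (intro eventually_ball_finite) auto
  moreover have "\<forall>\<^sub>\<approx>z\<in>W. z \<in> W"
    using W by (intro eventually_in_cosparse) auto
  ultimately show ?thesis
  proof eventually_elim
    case (elim z)
    have "continuous_on UNIV (\<lambda>\<xi>. pd (dxi_dir j) (R \<sigma> z) (x, \<xi>)) \<and>
      has_cutoff_integral (\<lambda>\<xi>. pd (dxi_dir j) (R \<sigma> z) (x, \<xi>)) 0" for j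
    proof -
      have diff: "\<tau> i z differentiable (at (x, \<xi>))" if "i < k" for i \<xi>
        using holomorphic_family_smooth_on[OF fam[OF that] elim(2)] U
        by (intro smooth_on_differentiable_at[of "U \<times> UNIV"] open_Times) auto
      have eq: "pd (dxi_dir j) (R \<sigma> z) (x, \<xi>) = (\<Sum>i<k. 1 * pd (dxi_dir j) (\<tau> i z) (x, \<xi>))" for \<xi>
      proof -
        have "((\<lambda>p. \<Sum>i<k. \<tau> i z p) has_derivative
           (\<lambda>h. \<Sum>i<k. frechet_derivative (\<tau> i z) (at (x, \<xi>)) h)) (at (x, \<xi>))"
          using diff by (intro has_derivative_sum) (simp add: frechet_derivative_works)
        from frechet_derivative_at[OF this]
        have "frechet_derivative (R \<sigma> z) (at (x, \<xi>)) = (\<lambda>h. \<Sum>i<k. frechet_derivative (\<tau> i z) (at (x, \<xi>)) h)"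
          using sum[OF elim(2)] by presburger
        then show ?thesis by (simp add: pd_def)
      qed
      have cont: "continuous_on UNIV (\<lambda>\<xi>. pd (dxi_dir j) (\<tau> i z) (x, \<xi>))" if "i < k" for i
        using smooth_on_fibre[OF holomorphic_family_smooth_on[OF fam[OF that] elim(2)] U(1) open_UNIV U(2)]
        unfolding C1_dir_on_def by blast
      have "has_cutoff_integral (\<lambda>\<xi>. \<Sum>i<k. 1 * pd (dxi_dir j) (\<tau> i z) (x, \<xi>)) 0"
        using cont elim holomorphic_family_expansion[OF fam elim(2) _ \<psi> U]
        by (intro has_cutoff_integral_lincomb) auto
      moreover have "continuous_on UNIV (\<lambda>\<xi>. \<Sum>i<k. 1 * pd (dxi_dir j) (\<tau> i z) (x, \<xi>))"
        using cont by (intro continuous_intros) auto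
      ultimately show ?thesis unfolding eq by blast
    qed
    then show ?case by blast
  qed
qed

text \<open>Agreement with the constant 0 off a sparse set already implies meromorphy.\<close>

lemma meromorphic_zero_onI:
  assumes "\<forall>\<^sub>\<approx>z\<in>W. F z = 0"
  shows "meromorphic_zero_on W F"
  using assms meromorphic_on_cong'[OF assms refl] meromorphic_on_const
  by (simp add: meromorphic_zero_on_def)

theorem theorem6:
  fixes U :: "(real ^ 'n::{finite,linorder}) set" and x :: "real ^ 'n::{finite,linorder}"
    and \<psi> :: "'n symb" and W :: "complex set"
    and R :: "'n symb \<Rightarrow> complex \<Rightarrow> 'n symb" and \<omega> :: "'n form"
  assumes "open U" and "x \<in> U"
    and "excision_function U \<psi>"
    and "open W" and "connected W" and "0 \<in> W"
    and "holomorphic_regularisation U \<psi> W R"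
    and "\<omega> \<in> Omega_CS_com U \<psi>"
  shows "meromorphic_zero_on W (\<lambda>z. fibre_cutoff_integral x
             (ext_differential (induced_regularisation R \<omega> z)) {})
       \<and> (\<forall>I. meromorphic_zero_on W (\<lambda>z. fibre_cutoff_integral x
             (fibre_differential (induced_regularisation R \<omega> z)) I))"
proof -
  have fibre: "meromorphic_zero_on W (\<lambda>z. fibre_cutoff_integral x
             (fibre_differential (induced_regularisation R \<omega> z)) I)" for I
  proof (rule meromorphic_zero_onI)
    \<comment> \<open>The top fibre degree involves one coefficient for each omitted index
      \<open>j\<close>, hence finitely many sparse sets.\<close>
    have "\<forall>\<^sub>\<approx>z\<in>W. \<forall>j\<in>UNIV. \<forall>i.
        continuous_on UNIV (\<lambda>\<xi>. pd (dxi_dir i) (R (\<omega> I (UNIV - {j})) z) (x, \<xi>)) \<and>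
        has_cutoff_integral (\<lambda>\<xi>. pd (dxi_dir i) (R (\<omega> I (UNIV - {j})) z) (x, \<xi>)) 0"
      using assms
      by (intro eventually_ball_finite ballI regularisation_expansion Omega_CS_com_coefficient) auto
    then show "\<forall>\<^sub>\<approx>z\<in>W. fibre_cutoff_integral x
        (fibre_differential (induced_regularisation R \<omega> z)) I = 0"
    proof eventually_elim
      case (elim z)
      have "has_cutoff_integral (\<lambda>\<xi>. \<Sum>j\<in>UNIV. ((-1) ^ card I * shuffle_sign {j} (UNIV - {j})) *
         pd (dxi_dir j) (R (\<omega> I (UNIV - {j})) z) (x, \<xi>)) 0"
        using elim by (intro has_cutoff_integral_lincomb) auto
      then show ?case
        unfolding fibre_cutoff_integral_def fibre_differential_def induced_regularisation_def
        by (rule cutoff_integral_eqI)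
    qed
  qed
  \<comment> \<open>The base part is a sum over the indices in \<open>I\<close>, which is empty
    here.\<close>
  have "ext_differential \<eta> {} = fibre_differential \<eta> {}" for \<eta> :: "'n form"
    by (simp add: fun_eq_iff ext_differential_def base_differential_def)
  then have "meromorphic_zero_on W (\<lambda>z. fibre_cutoff_integral x
             (ext_differential (induced_regularisation R \<omega> z)) {})"
    using fibre[of "{}"] by (simp add: fibre_cutoff_integral_def)
  then show ?thesis using fibre by blast
qed

end
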